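(* For $i=1,2$, let $K_i\in\mathscr K_T(\mathcal{H}_{\mathrm r})$, $F_i\in L^1(0,T;\mathcal{H}_{\mathrm r})$, $z_{0,i}\in\mathcal{H}_{\mathrm r}$, and let $z_i\in\mathcal{C}([0,T];\mathcal{H}_{\mathrm r})$ be the mild solution of $$\frac{d}{dt}z_i(t)=Az_i(t)+(K_i*z_i)(t)+F_i(t),\qquad z_i(0)=z_{0,i}.$$ Set $\kappa_*:=\max_{i=1,2}\|K_i\|_{\mathscr K_T(\mathcal{H}_{\mathrm r})}$. Then $$\|z_1-z_2\|_{\mathcal{C}([0,T];\mathcal{H}_{\mathrm r})}\le\sigma_T\exp(\sigma_T\kappa_*T)\Bigl[\|z_{0,1}-z_{0,2}\|_{\mathcal{H}_{\mathrm r}}+\|F_1-F_2\|_{L^1(0,T;\mathcal{H}_{\mathrm r})}+T\|K_1-K_2\|_{\mathscr K_T(\mathcal{H}_{\mathrm r})}\|z_2\|_{\mathcal{C}([0,T];\mathcal{H}_{\mathrm r})}\Bigr].$$ In particular, if $z_{0,n}\to z_0$ in $\mathcal{H}_{\mathrm r}$, $F_n\to F$ in $L^1(0,T;\mathcal{H}_{\mathrm r})$ and $K_n\to K$ in $\mathscr K_T(\mathcal{H}_{\mathrm r})$, then the corresponding mild solutions $z_n$ (with data $K_n,F_n,z_{0,n}$) and $z$ (with data $K,F,z_0$) satisfy $z_n\to z$ in $\mathcal{C}([0,T];\mathcal{H}_{\mathrm r})$.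
   Context: $\mathcal{H}_{\mathrm r}$ is a separable real Hilbert space and $T>0$ is fixed. $A:D(A)\subset\mathcal{H}_{\mathrm r}\to\mathcal{H}_{\mathrm r}$ generates a strongly continuous semigroup $S_A(t)$ with $\|S_A(t)\|\le Me^{\omega t}$ for $t\ge0$, for some $M\ge1$, $\omega\in\mathbb{R}$; $\sigma_T:=Me^{\max\{\omega,0\}T}$. $\mathscr K_T(\mathcal{H}_{\mathrm r})$ is the space of functions $K$ on $[0,T]$ with values in the bounded linear operators on $\mathcal{H}_{\mathrm r}$ such that $t\mapsto K(t)v$ is strongly measurable for every $v\in\mathcal{H}_{\mathrm r}$ and $\|K\|_{\mathscr K_T(\mathcal{H}_{\mathrm r})}:=\int_0^T\|K(t)\|\,dt<\infty$ (operator norm), with kernels identified when the norm of their difference vanishes. $(K*z)(t):=\int_0^tK(t-s)z(s)\,ds$ (Bochner integral). A mild solution of $z'=Az+K*z+F$, $z(0)=z_0$ on $[0,T]$ is a function $z\in\mathcal{C}([0,T];\mathcal{H}_{\mathrm r})$ with $$z(t)=S_A(t)z_0+\int_0^tS_A(t-s)F(s)\,ds+\int_0^tS_A(t-s)\int_0^sK(s-r)z(r)\,dr\,ds .$$ $\mathcal{C}([0,T];\mathcal{H}_{\mathrm r})$ carries the supremum norm. *)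

theory Defs
  imports "HOL-Analysis.Analysis"
begin

text \<open>
  Elements of function spaces over \<open>[0,T]\<close> are represented by total functions on \<^typ>\<open>real\<close> of which
  only the values on \<open>{0..T}\<close> matter. Kernels and forcing terms are functions rather than classes of
  almost everywhere equal functions, so equality in these spaces means that the norm of the
  difference vanishes. The state space is a type of sort
  \<open>{real_inner, banach, second_countable_topology}\<close>: a real Hilbert space that is second countable,
  i.e. separable. In it strong (Bochner) measurability is Lebesgue-to-Borel measurability.
\<close>

definition C0_semigroup :: "(real \<Rightarrow> 'h::real_normed_vector \<Rightarrow>\<^sub>L 'h) \<Rightarrow> bool" where
  "C0_semigroup S \<longleftrightarrow>
     S 0 = id_blinfun \<and>
     (\<forall>s\<ge>0. \<forall>t\<ge>0. S (s + t) = S s o\<^sub>L S t) \<and>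
     (\<forall>x. continuous_on {0..} (\<lambda>t. blinfun_apply (S t) x))"

text \<open>
  The unbounded operator \<open>A\<close> with domain \<open>D\<close> is the infinitesimal generator of \<open>S\<close>; the values of the
  total function \<open>A\<close> outside \<open>D\<close> are irrelevant.
\<close>

definition generates_semigroup ::
    "'h::real_normed_vector set \<Rightarrow> ('h \<Rightarrow> 'h) \<Rightarrow> (real \<Rightarrow> 'h \<Rightarrow>\<^sub>L 'h) \<Rightarrow> bool" where
  "generates_semigroup D A S \<longleftrightarrow>
     C0_semigroup S \<and>
     D = {x. \<exists>y. ((\<lambda>h. (1 / h) *\<^sub>R (blinfun_apply (S h) x - x)) \<longlongrightarrow> y) (at_right 0)} \<and>
     (\<forall>x\<in>D. ((\<lambda>h. (1 / h) *\<^sub>R (blinfun_apply (S h) x - x)) \<longlongrightarrow> A x) (at_right 0))"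

text \<open>
  Only strong measurability of the kernel is required; measurability of \<open>t \<mapsto> \<parallel>K t\<parallel>\<close> then follows from
  separability, so the extended integral below is the usual one and, when it is finite, it agrees
  with the real-valued integral in \<open>kernel_norm\<close>.
\<close>

definition kernel_space ::
    "real \<Rightarrow> (real \<Rightarrow> 'h::{real_inner, banach, second_countable_topology} \<Rightarrow>\<^sub>L 'h) set" where
  "kernel_space T =
     {K. (\<forall>v. set_borel_measurable lebesgue {0..T} (\<lambda>t. blinfun_apply (K t) v)) \<and>
         (\<integral>\<^sup>+t\<in>{0..T}. ennreal (norm (K t)) \<partial>lebesgue) < \<infinity>}"

definition kernel_norm :: "real \<Rightarrow> (real \<Rightarrow> 'h::real_normed_vector \<Rightarrow>\<^sub>L 'h) \<Rightarrow> real" where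
  "kernel_norm T K = (LINT t:{0..T}|lebesgue. norm (K t))"

definition L1_space ::
    "real \<Rightarrow> (real \<Rightarrow> 'h::{real_inner, banach, second_countable_topology}) set" where
  "L1_space T = {F. set_integrable lebesgue {0..T} F}"

definition L1_norm :: "real \<Rightarrow> (real \<Rightarrow> 'h::real_normed_vector) \<Rightarrow> real" where
  "L1_norm T F = (LINT t:{0..T}|lebesgue. norm (F t))"

definition sup_norm :: "real \<Rightarrow> (real \<Rightarrow> 'h::real_normed_vector) \<Rightarrow> real" where
  "sup_norm T z = (SUP t\<in>{0..T}. norm (z t))"

definition kernel_conv ::
    "(real \<Rightarrow> 'h::{real_inner, banach, second_countable_topology} \<Rightarrow>\<^sub>L 'h) \<Rightarrow> (real \<Rightarrow> 'h) \<Rightarrow> real \<Rightarrow> 'h"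
  where
  "kernel_conv K z t = (LINT s:{0..t}|lebesgue. blinfun_apply (K (t - s)) (z s))"

definition mild_solution ::
    "real \<Rightarrow> (real \<Rightarrow> 'h::{real_inner, banach, second_countable_topology} \<Rightarrow>\<^sub>L 'h) \<Rightarrow>
     (real \<Rightarrow> 'h \<Rightarrow>\<^sub>L 'h) \<Rightarrow> (real \<Rightarrow> 'h) \<Rightarrow> 'h \<Rightarrow> (real \<Rightarrow> 'h) \<Rightarrow> bool" where
  "mild_solution T S K F z0 z \<longleftrightarrow>
     continuous_on {0..T} z \<and>
     (\<forall>t\<in>{0..T}.
        z t = blinfun_apply (S t) z0
            + (LINT s:{0..t}|lebesgue. blinfun_apply (S (t - s)) (F s))
            + (LINT s:{0..t}|lebesgue. blinfun_apply (S (t - s)) (kernel_conv K z s)))"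

end

theory Submission imports Defs begin

text \<open>
  The difference \<open>w = z1 - z2\<close> satisfies the mild equation with kernel \<open>K1\<close>, initial value \<open>z01 - z02\<close>
  and forcing \<open>F1 - F2 + (K1 - K2) * z2\<close>. With \<open>c = \<sigma> * \<parallel>K1\<parallel>\<close>, measuring \<open>w\<close> in the maximum norm
  weighted by \<open>exp (- c * t)\<close> turns this equation into the claimed bound, since
  \<open>\<parallel>(K1 * w) s\<parallel> \<le> \<parallel>K1\<parallel> * sup {\<parallel>w r\<parallel> | r \<le> s}\<close>. Splitting the Bochner integrals requires
  \<open>K * z\<close> to be measurable; it is even continuous, by dominated convergence applied to
  \<open>\<integral> K s (z (t - s)) ds\<close>: inside the integral, \<open>t\<close> enters only
  the continuous factor.
\<close>

section \<open>Strongly measurable operator families\<close>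

text \<open>By separability, \<open>x\<close> is a pointwise limit of simple functions. A simple
  function takes finitely many values, so measurability of \<open>B\<close> against fixed vectors is
  enough for each approximant, and continuity of every single \<open>B t\<close> passes to the
  limit.\<close>

lemma borel_measurable_blinfun_apply_strong:
  fixes B :: "'a \<Rightarrow> 'b::{real_normed_vector, second_countable_topology} \<Rightarrow>\<^sub>L 'c::real_normed_vector"
  assumes B: "\<And>v. (\<lambda>t. B t v) \<in> borel_measurable M"
    and x: "x \<in> borel_measurable M"
  shows "(\<lambda>t. B t (x t)) \<in> borel_measurable M"
proof -
  obtain X where X: "\<And>i. simple_function M (X i)" "\<And>t. t \<in> space M \<Longrightarrow> (\<lambda>i. X i t) \<longlonglongrightarrow> x t"
    using borel_measurable_implies_sequence_metric[OF x] by blast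
  show ?thesis
  proof (rule borel_measurable_LIMSEQ_metric)
    fix i
    have "X i \<in> M \<rightarrow>\<^sub>M count_space (X i ` space M)"
      using X(1) by (simp add: simple_function_def measurable_count_space_eq2)
    then show "(\<lambda>t. B t (X i t)) \<in> borel_measurable M"
      by (rule measurable_compose_countable'[where f = "\<lambda>v t. B t v", OF B])
        (use X(1)[of i] in \<open>simp add: simple_function_def countable_finite\<close>)
  next
    fix t assume "t \<in> space M"
    then show "(\<lambda>i. B t (X i t)) \<longlonglongrightarrow> B t (x t)"
      using X(2) by (intro tendsto_intros)
  qed
qed

lemma set_borel_measurable_blinfun_apply_strong:
  fixes B :: "'a \<Rightarrow> 'b::{real_normed_vector, second_countable_topology} \<Rightarrow>\<^sub>L 'c::real_normed_vector"
  assumes B: "\<And>v. set_borel_measurable M A (\<lambda>t. B t v)"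
    and x: "set_borel_measurable M A x"
  shows "set_borel_measurable M A (\<lambda>t. B t (x t))"
proof -
  \<comment> \<open>The indicator multiplies both factors because each is known to be measurable
    only on \<open>A\<close>; the product of the two indicators is again the indicator of
    \<open>A\<close>.\<close>
  have "(\<lambda>t. (indicator A t *\<^sub>R B t) (indicator A t *\<^sub>R x t)) \<in> borel_measurable M"
    by (rule borel_measurable_blinfun_apply_strong)
      (use assms in \<open>simp_all add: set_borel_measurable_def scaleR_blinfun.rep_eq\<close>)
  moreover have "(\<lambda>t. (indicator A t *\<^sub>R B t) (indicator A t *\<^sub>R x t))
      = (\<lambda>t. indicator A t *\<^sub>R B t (x t))"
    by (auto simp: scaleR_blinfun.rep_eq indicator_def of_bool_def)
  ultimately show ?thesis
    by (simp add: set_borel_measurable_def)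
qed

text \<open>For \<open>a\<close> nonnegative, the vectors satisfying
  \<open>norm (f x) \<le> a * norm x\<close> form a closed set, so testing them on a countable dense
  set decides \<open>norm f \<le> a\<close>. Each sublevel set of the norm is thus a countable
  intersection of measurable sets.\<close>

lemma borel_measurable_norm_blinfun_strong:
  fixes B :: "'a \<Rightarrow> 'b::{real_normed_vector, second_countable_topology} \<Rightarrow>\<^sub>L 'c::real_normed_vector"
  assumes B: "\<And>v. (\<lambda>t. B t v) \<in> borel_measurable M"
  shows "(\<lambda>t. norm (B t)) \<in> borel_measurable M"
proof -
  obtain D :: "'b set" where D: "countable D" "\<And>X. open X \<Longrightarrow> X \<noteq> {} \<Longrightarrow> \<exists>d\<in>D. d \<in> X"
    by (erule countable_dense_setE)
  have closure_D: "closure D = UNIV"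
    using D(2)[of "- closure D"] closure_subset[of D] by auto
  have norm_le_iff: "norm f \<le> a \<longleftrightarrow> (\<forall>d\<in>D. norm (f d) \<le> a * norm d)" if "0 \<le> a"
    for a and f :: "'b \<Rightarrow>\<^sub>L 'c"
  proof
    assume "norm f \<le> a"
    then show "\<forall>d\<in>D. norm (f d) \<le> a * norm d"
      by (meson mult_right_mono norm_blinfun norm_ge_zero order_trans)
  next
    assume le: "\<forall>d\<in>D. norm (f d) \<le> a * norm d"
    have "closed {x. norm (f x) \<le> a * norm x}"
      by (intro closed_Collect_le continuous_intros)
    then have "closure D \<subseteq> {x. norm (f x) \<le> a * norm x}"
      using le by (intro closure_minimal) auto
    then show "norm f \<le> a"
      using that closure_D by (intro norm_blinfun_bound) auto
  qed
  have "{t \<in> space M. norm (B t) \<le> a} \<in> sets M" for a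
  proof (cases "0 \<le> a")
    case True
    have "{t \<in> space M. \<forall>d\<in>D. norm (B t d) \<le> a * norm d} \<in> sets M"
      using B by (intro sets.sets_Collect_countable_All' D(1) borel_measurable_le
          measurable_compose[OF B borel_measurable_norm] borel_measurable_const)
    then show ?thesis
      using norm_le_iff[OF True] by simp
  next
    case False
    then have "{t \<in> space M. norm (B t) \<le> a} = {}"
      by (auto dest: order_trans[OF norm_ge_zero])
    then show ?thesis
      by (metis sets.empty_sets)
  qed
  then show ?thesis
    by (simp add: borel_measurable_iff_le)
qed

section \<open>The kernel space and its norm\<close>

text \<open>Strong measurability makes the operator norm measurable, and the finite extended
  integral then gives integrability. This supplies the integrable majorants for the
  convolution.\<close>

lemma kernel_space_integrable_norm:
  assumes "K \<in> kernel_space T"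
  shows "set_integrable lebesgue {0..T} (\<lambda>t. norm (K t))"
proof -
  have "(\<lambda>t. norm (indicator {0..T} t *\<^sub>R K t)) \<in> borel_measurable lebesgue"
    using assms unfolding kernel_space_def set_borel_measurable_def
    by (intro borel_measurable_norm_blinfun_strong) (simp add: scaleR_blinfun.rep_eq)
  moreover have "norm (indicator {0..T} t *\<^sub>R K t) = indicator {0..T} t *\<^sub>R norm (K t)" for t
    by (simp add: indicator_def)
  moreover have "(\<integral>\<^sup>+t. ennreal (norm (indicator {0..T} t *\<^sub>R norm (K t))) \<partial>lebesgue)
      = (\<integral>\<^sup>+t\<in>{0..T}. ennreal (norm (K t)) \<partial>lebesgue)"
    by (intro nn_integral_cong) (simp add: indicator_def)
  ultimately show ?thesis
    using assms unfolding set_integrable_def integrable_iff_bounded kernel_space_def by simp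
qed

lemma kernel_norm_nonneg: "0 \<le> kernel_norm T K"
  unfolding kernel_norm_def set_lebesgue_integral_def by (intro Bochner_Integration.integral_nonneg) simp

lemma L1_norm_nonneg: "0 \<le> L1_norm T F"
  unfolding L1_norm_def set_lebesgue_integral_def by (intro Bochner_Integration.integral_nonneg) simp

text \<open>The difference of two kernels later acts as a kernel itself, convolved with the second
  solution. Its norm is dominated by the integrable sum of the two norms.\<close>

lemma kernel_space_diff:
  assumes "K1 \<in> kernel_space T" "K2 \<in> kernel_space T"
  shows "(\<lambda>t. K1 t - K2 t) \<in> kernel_space T"
proof -
  have meas: "set_borel_measurable lebesgue {0..T} (\<lambda>t. (K1 t - K2 t) v)" for v
    using assms unfolding kernel_space_def set_borel_measurable_def
    by (simp add: minus_blinfun.rep_eq scaleR_diff_right borel_measurable_diff)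
  have "(\<lambda>t. norm (indicator {0..T} t *\<^sub>R (K1 t - K2 t))) \<in> borel_measurable lebesgue"
    using meas unfolding set_borel_measurable_def
    by (intro borel_measurable_norm_blinfun_strong) (simp add: scaleR_blinfun.rep_eq)
  moreover have "norm (indicator {0..T} t *\<^sub>R (K1 t - K2 t)) =
      indicator {0..T} t *\<^sub>R norm (K1 t - K2 t)" for t
    by (simp add: indicator_def)
  ultimately have "set_integrable lebesgue {0..T} (\<lambda>t. norm (K1 t - K2 t))"
    using norm_triangle_ineq4
    by (intro set_integrable_bound[OF set_integral_add(1)[OF kernel_space_integrable_norm[OF assms(1)]
          kernel_space_integrable_norm[OF assms(2)]]])
      (auto simp: set_borel_measurable_def)
  then have "(\<integral>\<^sup>+t. ennreal (norm (indicator {0..T} t *\<^sub>R norm (K1 t - K2 t))) \<partial>lebesgue) < \<infinity>"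
    unfolding set_integrable_def integrable_iff_bounded by simp
  also have "(\<integral>\<^sup>+t. ennreal (norm (indicator {0..T} t *\<^sub>R norm (K1 t - K2 t))) \<partial>lebesgue)
      = (\<integral>\<^sup>+t\<in>{0..T}. ennreal (norm (K1 t - K2 t)) \<partial>lebesgue)"
    by (intro nn_integral_cong) (simp add: indicator_def)
  finally show ?thesis
    using meas by (simp add: kernel_space_def)
qed

section \<open>Continuous functions on compact intervals\<close>

lemma set_borel_measurable_lebesgue_continuous:
  fixes f :: "real \<Rightarrow> 'b::real_normed_vector"
  assumes "continuous_on {a..b} f"
  shows "set_borel_measurable lebesgue {a..b} f"
  using borel_measurable_continuous_on_indicator[OF _ assms]
  unfolding set_borel_measurable_def by (simp add: measurable_completion)

lemma set_integrable_lebesgue_continuous: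
  fixes f :: "real \<Rightarrow> 'b::{banach, second_countable_topology}"
  assumes "continuous_on {a..b} f"
  shows "set_integrable lebesgue {a..b} f"
  using borel_integrable_compact[OF compact_Icc assms]
  unfolding set_integrable_def by (simp add: integrable_completion)

lemma continuous_on_reflect:
  fixes z :: "real \<Rightarrow> 'b::topological_space"
  assumes "continuous_on {0..t} z"
  shows "continuous_on {0..t} (\<lambda>s. z (t - s))"
  by (rule continuous_on_compose2[OF assms]) (auto intro!: continuous_intros)

lemma indicator_Icc_reflect: "indicator {0..t} (t - s) = (indicator {0..t::real} s :: real)"
  by (auto simp: indicator_def)

lemma sup_norm_upper:
  assumes "continuous_on {0..T} z" "t \<in> {0..T}"
  shows "norm (z t) \<le> sup_norm T z"
proof -
  have "compact ((\<lambda>t. norm (z t)) ` {0..T})"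
    by (intro compact_continuous_image continuous_intros assms compact_Icc)
  then show ?thesis
    unfolding sup_norm_def
    by (intro cSUP_upper assms) (auto intro: bounded_imp_bdd_above compact_imp_bounded)
qed

lemma sup_norm_nonneg:
  assumes "continuous_on {0..T} z" "0 \<le> T"
  shows "0 \<le> sup_norm T z"
  using order_trans[OF norm_ge_zero sup_norm_upper[OF assms(1), of 0]] assms(2) by simp

section \<open>The convolution of a kernel with a continuous function\<close>

text \<open>The maximum of \<open>norm (z s)\<close> on \<open>{0..t}\<close> times
  \<open>norm (K s)\<close> is an integrable majorant. In this reflected form the strong
  measurability of \<open>K\<close> applies without a change of variables.\<close>

lemma kernel_conv_integrand:
  assumes K: "K \<in> kernel_space T" and t: "t \<in> {0..T}" and z: "continuous_on {0..t} z"
  shows "set_integrable lebesgue {0..t} (\<lambda>s. K s (z (t - s)))"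
proof -
  define b where "b = sup_norm t z"
  have b: "0 \<le> b" "\<And>s. s \<in> {0..t} \<Longrightarrow> norm (z s) \<le> b"
    using t sup_norm_nonneg[OF z] sup_norm_upper[OF z] by (auto simp: b_def)
  have "set_borel_measurable lebesgue {0..t} (\<lambda>s. K s v)" for v
    using K t unfolding kernel_space_def
    by (auto intro: set_borel_measurable_subset[where A = "{0..T}"])
  then have meas: "set_borel_measurable lebesgue {0..t} (\<lambda>s. K s (z (t - s)))"
    by (rule set_borel_measurable_blinfun_apply_strong)
      (intro set_borel_measurable_lebesgue_continuous continuous_on_reflect z)
  have int: "set_integrable lebesgue {0..t} (\<lambda>s. b * norm (K s))"
    using set_integrable_subset[OF kernel_space_integrable_norm[OF K], of "{0..t}"] t by auto
  have "norm (K s (z (t - s))) \<le> b * norm (K s)" if "s \<in> {0..t}" for s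
    using that by (subst mult.commute) (intro order_trans[OF norm_blinfun] mult_left_mono b(2), auto)
  then show ?thesis
    by (intro set_integrable_bound[OF int meas] AE_I2) (use b in auto)
qed

text \<open>Reflection is the affine map of slope -1, whose density factor is the absolute value of
  the slope, namely 1.\<close>

lemma lebesgue_distr_reflect: "distr lebesgue lebesgue (\<lambda>s. t - s) = (lebesgue :: real measure)"
  using lebesgue_real_affine[of "-1" t] by (simp add: density_1)

text \<open>The reflection of \<open>{0..t}\<close> preserves Lebesgue measure and maps the interval
  to itself. The estimates, the continuity and the difference formula for \<open>kernel_conv\<close>
  all start from this form.\<close>

lemma kernel_conv_commute:
  assumes "K \<in> kernel_space T" "t \<in> {0..T}" "continuous_on {0..t} z"
  shows "kernel_conv K z t = (LINT s:{0..t}|lebesgue. K s (z (t - s)))"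
proof -
  have meas: "(\<lambda>s. indicator {0..t} s *\<^sub>R K s (z (t - s))) \<in> borel_measurable lebesgue"
    using kernel_conv_integrand[OF assms] by (auto simp: set_integrable_def)
  have "(\<lambda>s. t - s) \<in> lebesgue \<rightarrow>\<^sub>M lebesgue"
    using lebesgue_affine_measurable[of "\<lambda>_. -1" t] by simp
  then have "(LINT s|lebesgue. indicator {0..t} s *\<^sub>R K s (z (t - s)))
      = (LINT s|lebesgue. indicator {0..t} (t - s) *\<^sub>R K (t - s) (z (t - (t - s))))"
    using integral_distr[OF _ meas, of "\<lambda>s. t - s" lebesgue]
    unfolding lebesgue_distr_reflect by blast
  then show ?thesis
    by (simp add: kernel_conv_def set_lebesgue_integral_def indicator_Icc_reflect)
qed

text \<open>The bound \<open>b\<close> concerns \<open>z\<close> only up to time \<open>t\<close>,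
  so it may be chosen depending on \<open>t\<close>; the exponentially weighted estimate relies on
  this.\<close>

lemma norm_kernel_conv_le:
  assumes K: "K \<in> kernel_space T" and t: "t \<in> {0..T}" and z: "continuous_on {0..t} z"
    and b: "\<And>s. s \<in> {0..t} \<Longrightarrow> norm (z s) \<le> b"
  shows "norm (kernel_conv K z t) \<le> kernel_norm T K * b"
proof -
  have "0 \<le> b"
    using order_trans[OF norm_ge_zero b[of 0]] t by simp
  have int: "set_integrable lebesgue {0..t} (\<lambda>s. norm (K s))"
    using set_integrable_subset[OF kernel_space_integrable_norm[OF K], of "{0..t}"] t by auto
  have "norm (kernel_conv K z t) \<le> (LINT s:{0..t}|lebesgue. norm (K s (z (t - s))))"
    unfolding kernel_conv_commute[OF K t z]
    by (intro set_integral_norm_bound kernel_conv_integrand[OF K t z])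
  also have "\<dots> \<le> (LINT s:{0..t}|lebesgue. norm (K s) * b)"
  proof (rule set_integral_mono)
    show "norm (K s (z (t - s))) \<le> norm (K s) * b" if "s \<in> {0..t}" for s
      using that by (intro order_trans[OF norm_blinfun] mult_left_mono b) auto
  qed (use int in \<open>auto intro: set_integrable_norm kernel_conv_integrand[OF K t z]\<close>)
  also have "\<dots> = (LINT s:{0..t}|lebesgue. norm (K s)) * b"
    by simp
  also have "(LINT s:{0..t}|lebesgue. norm (K s)) \<le> kernel_norm T K"
    using int kernel_space_integrable_norm[OF K] t
    unfolding kernel_norm_def set_lebesgue_integral_def set_integrable_def
    by (intro integral_mono) (auto simp: indicator_def)
  finally show ?thesis
    using \<open>0 \<le> b\<close> by (simp add: mult_right_mono)
qed

text \<open>Away from \<open>s = t\<close> the indicator is eventually constant along the sequence: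
  0 for \<open>s\<close> negative or beyond \<open>t\<close>, and 1 in between, where continuity of
  \<open>z\<close> decides. At \<open>s = t\<close> it may keep jumping between 0 and 1; this single
  point is a null set.\<close>

lemma kernel_conv_integrand_tendsto:
  fixes K :: "real \<Rightarrow> 'b::real_normed_vector \<Rightarrow>\<^sub>L 'c::real_normed_vector"
  assumes z: "continuous_on {0..T} z" and u: "\<forall>n. u n \<in> {0..T}" and t: "t \<in> {0..T}"
    and lim: "u \<longlonglongrightarrow> t" and "s \<noteq> t"
  shows "(\<lambda>n. indicator {0..u n} s *\<^sub>R K s (z (u n - s)))
    \<longlonglongrightarrow> indicator {0..t} s *\<^sub>R K s (z (t - s))"
proof -
  consider "s < 0" | "t < s" | "0 \<le> s" "s < t"
    using \<open>s \<noteq> t\<close> by linarith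
  then show ?thesis
  proof cases
    case 1
    then have "indicator {0..r} s = (0::real)" for r
      by simp
    then show ?thesis
      by simp
  next
    case 2
    then have "\<forall>\<^sub>F n in sequentially. u n < s"
      using order_tendstoD(2)[OF lim] by simp
    then have "\<forall>\<^sub>F n in sequentially. indicator {0..u n} s *\<^sub>R K s (z (u n - s)) = 0"
      by eventually_elim simp
    then have "(\<lambda>n. indicator {0..u n} s *\<^sub>R K s (z (u n - s))) \<longlonglongrightarrow> 0"
      by (rule tendsto_eventually)
    then show ?thesis
      using 2 by simp
  next
    case 3
    have less: "\<forall>\<^sub>F n in sequentially. s < u n"
      using order_tendstoD(1)[OF lim 3(2)] .
    then have ev: "\<forall>\<^sub>F n in sequentially. K s (z (u n - s)) = indicator {0..u n} s *\<^sub>R K s (z (u n - s))"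
      by eventually_elim (use 3 in simp)
    \<comment> \<open>Continuity of \<open>z\<close> is available only relative to
      \<open>{0..T}\<close>, so the shifted times must eventually lie there.\<close>
    from less have ev': "\<forall>\<^sub>F n in sequentially. u n - s \<in> {0..T}"
    proof eventually_elim
      case (elim n)
      then show ?case
        using 3 u[rule_format, of n] by simp
    qed
    have "(\<lambda>n. u n - s) \<longlonglongrightarrow> t - s"
      by (intro tendsto_intros lim)
    then have "(\<lambda>n. z (u n - s)) \<longlonglongrightarrow> z (t - s)"
      by (rule continuous_on_tendsto_compose[OF z _ _ ev']) (use 3 t in simp)
    then have "(\<lambda>n. K s (z (u n - s))) \<longlonglongrightarrow> K s (z (t - s))"
      by (rule blinfun.tendsto[OF tendsto_const])
    then have "(\<lambda>n. indicator {0..u n} s *\<^sub>R K s (z (u n - s))) \<longlonglongrightarrow> K s (z (t - s))"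
      using ev by (rule Lim_transform_eventually)
    then show ?thesis
      using 3 by simp
  qed
qed

lemma continuous_on_kernel_conv:
  assumes K: "K \<in> kernel_space T" and z: "continuous_on {0..T} z"
  shows "continuous_on {0..T} (kernel_conv K z)"
proof (rule continuous_on_sequentiallyI)
  fix u t
  assume u: "\<forall>n. u n \<in> {0..T}" and t: "t \<in> {0..T}" and lim: "u \<longlonglongrightarrow> t"
  have z': "continuous_on {0..r} z" if "r \<in> {0..T}" for r
    using that by (intro continuous_on_subset[OF z]) auto
  define b where "b = sup_norm T z"
  have b: "0 \<le> b" "\<And>s. s \<in> {0..T} \<Longrightarrow> norm (z s) \<le> b"
    using t sup_norm_nonneg[OF z] sup_norm_upper[OF z] by (auto simp: b_def)
  show "(\<lambda>n. kernel_conv K z (u n)) \<longlonglongrightarrow> kernel_conv K z t"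
    unfolding kernel_conv_commute[OF K u[rule_format] z'[OF u[rule_format]]]
      kernel_conv_commute[OF K t z'[OF t]] set_lebesgue_integral_def
  proof (rule integral_dominated_convergence)
    \<comment> \<open>Since every \<open>u n\<close> is at most \<open>T\<close>, extending the
      majorant to \<open>{0..T}\<close> makes it independent of \<open>n\<close>.\<close>
    show "integrable lebesgue (\<lambda>s. indicator {0..T} s *\<^sub>R (norm (K s) * b))"
      using set_integrable_mult_left[OF kernel_space_integrable_norm[OF K], of b]
      by (simp only: set_integrable_def)
    show "(\<lambda>s. indicator {0..t} s *\<^sub>R K s (z (t - s))) \<in> borel_measurable lebesgue"
      using kernel_conv_integrand[OF K t z'[OF t]] by (auto simp: set_integrable_def)
    show "(\<lambda>s. indicator {0..u n} s *\<^sub>R K s (z (u n - s))) \<in> borel_measurable lebesgue" for n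
      using kernel_conv_integrand[OF K _ z', of "u n"] u by (auto simp: set_integrable_def)
    show "AE s in lebesgue. norm (indicator {0..u n} s *\<^sub>R K s (z (u n - s)))
        \<le> indicator {0..T} s *\<^sub>R (norm (K s) * b)" for n
    proof (rule AE_I2)
      fix s
      show "norm (indicator {0..u n} s *\<^sub>R K s (z (u n - s)))
        \<le> indicator {0..T} s *\<^sub>R (norm (K s) * b)"
      proof (cases "s \<in> {0..u n}")
        case True
        then have "norm (K s (z (u n - s))) \<le> norm (K s) * b"
          using u[rule_format, of n] by (intro order_trans[OF norm_blinfun] mult_left_mono b(2)) auto
        then show ?thesis
          using True u[rule_format, of n] by (simp add: indicator_def)
      qed (use b(1) in auto)
    qed
    have "AE s in lebesgue. s \<noteq> t"
      by (rule AE_completion[OF AE_lborel_singleton])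
    then show "AE s in lebesgue. (\<lambda>n. indicator {0..u n} s *\<^sub>R K s (z (u n - s)))
        \<longlonglongrightarrow> indicator {0..t} s *\<^sub>R K s (z (t - s))"
      by eventually_elim (rule kernel_conv_integrand_tendsto[OF z u t lim])
  qed
qed

text \<open>Adding and subtracting \<open>K1\<close> convolved with \<open>z2\<close> separates the
  unknown difference from a known forcing term. This choice is why the final bound contains
  \<open>sup_norm T z2\<close>.\<close>

lemma kernel_conv_diff:
  assumes K: "K1 \<in> kernel_space T" "K2 \<in> kernel_space T" and t: "t \<in> {0..T}"
    and z: "continuous_on {0..T} z1" "continuous_on {0..T} z2"
  shows "kernel_conv K1 z1 t - kernel_conv K2 z2 t
    = kernel_conv K1 (\<lambda>s. z1 s - z2 s) t + kernel_conv (\<lambda>s. K1 s - K2 s) z2 t"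
proof -
  have z': "continuous_on {0..t} z1" "continuous_on {0..t} z2"
    using z t by (auto intro: continuous_on_subset)
  have w: "continuous_on {0..t} (\<lambda>s. z1 s - z2 s)"
    by (intro continuous_intros z')
  note dK = kernel_space_diff[OF K]
  have "kernel_conv K1 z1 t - kernel_conv K2 z2 t
      = (LINT s:{0..t}|lebesgue. K1 s (z1 (t - s)) - K2 s (z2 (t - s)))"
    unfolding kernel_conv_commute[OF K(1) t z'(1)] kernel_conv_commute[OF K(2) t z'(2)]
    by (rule set_integral_diff(2)[symmetric]) (rule kernel_conv_integrand[OF _ t] K z')+
  also have "\<dots> = (LINT s:{0..t}|lebesgue. K1 s (z1 (t - s) - z2 (t - s)) + (K1 s - K2 s) (z2 (t - s)))"
    by (simp add: minus_blinfun.rep_eq blinfun.diff_right)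
  also have "\<dots> = kernel_conv K1 (\<lambda>s. z1 s - z2 s) t + kernel_conv (\<lambda>s. K1 s - K2 s) z2 t"
    unfolding kernel_conv_commute[OF K(1) t w] kernel_conv_commute[OF dK t z'(2)]
    by (intro set_integral_add(2) kernel_conv_integrand[OF K(1) t w] kernel_conv_integrand[OF dK t z'(2)])
  finally show ?thesis .
qed

section \<open>Semigroup integrals and the exponential weight\<close>

text \<open>Strong continuity makes the semigroup strongly measurable, and the uniform bound
  \<open>\<sigma>\<close> gives the integrable majorant
  \<open>\<sigma> * norm (g s)\<close>.\<close>

lemma semigroup_integrand:
  fixes S :: "real \<Rightarrow> 'h::{real_inner, banach, second_countable_topology} \<Rightarrow>\<^sub>L 'h"
  assumes S: "\<And>x. continuous_on {0..} (\<lambda>t. S t x)"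
    and \<sigma>: "\<And>s. s \<in> {0..t} \<Longrightarrow> norm (S s) \<le> \<sigma>"
    and g: "set_integrable lebesgue {0..t} g"
  shows "set_integrable lebesgue {0..t} (\<lambda>s. S (t - s) (g s))"
proof -
  have "set_borel_measurable lebesgue {0..t} (\<lambda>s. S (t - s) v)" for v
    by (rule set_borel_measurable_lebesgue_continuous, rule continuous_on_reflect,
        rule continuous_on_subset[OF S]) auto
  then have meas: "set_borel_measurable lebesgue {0..t} (\<lambda>s. S (t - s) (g s))"
    by (rule set_borel_measurable_blinfun_apply_strong)
      (use g in \<open>auto simp: set_integrable_def set_borel_measurable_def\<close>)
  have int: "set_integrable lebesgue {0..t} (\<lambda>s. \<sigma> * norm (g s))"
    using g by (auto intro: set_integrable_norm)
  have "norm (S (t - s) (g s)) \<le> \<sigma> * norm (g s)" if "s \<in> {0..t}" for s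
    using that by (intro order_trans[OF norm_blinfun] mult_right_mono \<sigma>) auto
  then show ?thesis
    by (intro set_integrable_bound[OF int meas] AE_I2) (metis abs_ge_self order_trans real_norm_def)
qed

lemma norm_semigroup_integral_le:
  fixes S :: "real \<Rightarrow> 'h::{real_inner, banach, second_countable_topology} \<Rightarrow>\<^sub>L 'h"
  assumes S: "\<And>x. continuous_on {0..} (\<lambda>t. S t x)"
    and \<sigma>: "\<And>s. s \<in> {0..t} \<Longrightarrow> norm (S s) \<le> \<sigma>"
    and g: "set_integrable lebesgue {0..t} g"
  shows "norm (LINT s:{0..t}|lebesgue. S (t - s) (g s)) \<le> \<sigma> * L1_norm t g"
proof -
  note int = semigroup_integrand[OF S \<sigma> g]
  have "norm (LINT s:{0..t}|lebesgue. S (t - s) (g s)) \<le> (LINT s:{0..t}|lebesgue. norm (S (t - s) (g s)))"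
    by (rule set_integral_norm_bound[OF int])
  also have "\<dots> \<le> (LINT s:{0..t}|lebesgue. \<sigma> * norm (g s))"
  proof (rule set_integral_mono)
    show "norm (S (t - s) (g s)) \<le> \<sigma> * norm (g s)" if "s \<in> {0..t}" for s
      using that by (intro order_trans[OF norm_blinfun] mult_right_mono \<sigma>) auto
  qed (use int g in \<open>auto intro: set_integrable_norm\<close>)
  finally show ?thesis
    by (simp add: L1_norm_def)
qed

lemma L1_norm_mono_interval:
  fixes F :: "real \<Rightarrow> 'b::{banach, second_countable_topology}"
  assumes "set_integrable lebesgue {0..T} F" "t \<le> T"
  shows "L1_norm t F \<le> L1_norm T F"
proof -
  have "set_integrable lebesgue {0..T} (\<lambda>s. norm (F s))"
    by (rule set_integrable_norm[OF assms(1)])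
  moreover from this have "set_integrable lebesgue {0..t} (\<lambda>s. norm (F s))"
    using set_integrable_subset[of lebesgue "{0..T}" _ "{0..t}"] assms(2) by auto
  ultimately show ?thesis
    using assms(2) unfolding L1_norm_def set_lebesgue_integral_def set_integrable_def
    by (intro integral_mono) (auto simp: indicator_def)
qed

text \<open>The maximum of \<open>norm (w t) * exp (- c * t)\<close> is at most \<open>b\<close>: evaluate the hypothesis where
  it is attained, with the maximum as \<open>q\<close>.\<close>

lemma exp_weighted_gronwall:
  fixes w :: "real \<Rightarrow> 'b::real_normed_vector"
  assumes w: "continuous_on {0..T} w" and c: "0 \<le> c" and t: "t \<in> {0..T}"
    and step: "\<And>q t. t \<in> {0..T} \<Longrightarrow> (\<And>r. r \<in> {0..t} \<Longrightarrow> norm (w r) \<le> q * exp (c * r))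
        \<Longrightarrow> norm (w t) \<le> b + q * (exp (c * t) - 1)"
  shows "norm (w t) \<le> b * exp (c * T)"
proof -
  have "continuous_on {0..T} (\<lambda>t. norm (w t) * exp (- c * t))"
    by (intro continuous_intros w)
  then have "\<exists>m\<in>{0..T}. \<forall>r\<in>{0..T}. norm (w r) * exp (- c * r) \<le> norm (w m) * exp (- c * m)"
    using t by (intro continuous_attains_sup[OF compact_Icc]) auto
  then obtain m where m: "m \<in> {0..T}"
    and max: "\<And>r. r \<in> {0..T} \<Longrightarrow> norm (w r) * exp (- c * r) \<le> norm (w m) * exp (- c * m)"
    by blast
  define q where "q = norm (w m) * exp (- c * m)"
  have le: "norm (w r) \<le> q * exp (c * r)" if "r \<in> {0..T}" for r
    using max[OF that] by (simp add: q_def exp_minus field_simps)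
  have "norm (w m) \<le> b + q * (exp (c * m) - 1)"
    using m by (intro step le) auto
  moreover have "norm (w m) = q * exp (c * m)"
    by (simp add: q_def exp_minus)
  \<comment> \<open>The term \<open>q * exp (c * m)\<close> occurs on both sides and
    cancels.\<close>
  ultimately have "q \<le> b"
    by (simp add: algebra_simps)
  have "0 \<le> q"
    by (simp add: q_def)
  have "norm (w t) \<le> q * exp (c * t)"
    by (rule le[OF t])
  also have "\<dots> \<le> b * exp (c * T)"
    using \<open>q \<le> b\<close> \<open>0 \<le> q\<close> c t by (intro mult_mono) (auto intro: mult_left_mono)
  finally show ?thesis .
qed

text \<open>Keeping the factor \<open>c\<close> on the left avoids a division, so
  \<open>c = 0\<close> needs no separate case.\<close>

lemma L1_norm_exp:
  assumes "0 \<le> t"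
  shows "c * L1_norm t (\<lambda>s. exp (c * s)) = exp (c * t) - 1"
proof -
  have "((\<lambda>s. c * exp (c * s)) has_integral (exp (c * t) - exp (c * 0))) {0..t}"
    using assms by (intro fundamental_theorem_of_calculus)
      (auto intro!: derivative_eq_intros simp flip: has_real_derivative_iff_has_vector_derivative)
  moreover have "set_integrable lebesgue {0..t} (\<lambda>s. c * exp (c * s))"
    by (intro set_integrable_lebesgue_continuous continuous_intros)
  from set_lebesgue_integral_eq_integral(2)[OF this]
  have "(LINT s:{0..t}|lebesgue. c * exp (c * s)) = integral {0..t} (\<lambda>s. c * exp (c * s))" .
  ultimately have "(LINT s:{0..t}|lebesgue. c * exp (c * s)) = exp (c * t) - 1"
    by (simp only: integral_unique) simp
  then show ?thesis
    by (simp add: L1_norm_def)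
qed

lemma L1_norm_le:
  fixes g :: "real \<Rightarrow> 'b::{banach, second_countable_topology}"
  assumes "continuous_on {0..t} g" "continuous_on {0..t} h"
    and "\<And>s. s \<in> {0..t} \<Longrightarrow> norm (g s) \<le> h s"
  shows "L1_norm t g \<le> (LINT s:{0..t}|lebesgue. h s)"
  unfolding L1_norm_def
  using assms by (intro set_integral_mono set_integrable_lebesgue_continuous continuous_intros)

section \<open>Stability of mild solutions\<close>

text \<open>Both mild equations are linear in their data, so they can be subtracted once every
  integrand is known to be integrable. For the convolution terms this follows from the continuity of
  the convolution.\<close>

lemma mild_solution_diff:
  fixes S :: "real \<Rightarrow> 'h::{real_inner, banach, second_countable_topology} \<Rightarrow>\<^sub>L 'h"
  assumes S: "\<And>x. continuous_on {0..} (\<lambda>t. S t x)"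
    and \<sigma>: "\<And>s. s \<in> {0..T} \<Longrightarrow> norm (S s) \<le> \<sigma>"
    and K: "K1 \<in> kernel_space T" "K2 \<in> kernel_space T"
    and F: "F1 \<in> L1_space T" "F2 \<in> L1_space T"
    and sol: "mild_solution T S K1 F1 z01 z1" "mild_solution T S K2 F2 z02 z2"
    and t: "t \<in> {0..T}"
  shows "z1 t - z2 t = S t (z01 - z02)
    + (LINT s:{0..t}|lebesgue. S (t - s) (F1 s - F2 s))
    + (LINT s:{0..t}|lebesgue. S (t - s) (kernel_conv K1 (\<lambda>r. z1 r - z2 r) s))
    + (LINT s:{0..t}|lebesgue. S (t - s) (kernel_conv (\<lambda>r. K1 r - K2 r) z2 s))"
proof -
  have z: "continuous_on {0..T} z1" "continuous_on {0..T} z2"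
    using sol by (auto simp: mild_solution_def)
  have \<sigma>': "norm (S s) \<le> \<sigma>" if "s \<in> {0..t}" for s
    using \<sigma> that t by simp
  note int = semigroup_integrand[OF S \<sigma>']
  have intK: "set_integrable lebesgue {0..t} (\<lambda>s. S (t - s) (kernel_conv K z s))"
    if "K \<in> kernel_space T" "continuous_on {0..T} z" for K z
    by (rule int, assumption, rule set_integrable_lebesgue_continuous,
        rule continuous_on_subset[OF continuous_on_kernel_conv[OF that]]) (use t in auto)
  have intF: "set_integrable lebesgue {0..t} (\<lambda>s. S (t - s) (F s))" if "F \<in> L1_space T" for F
    by (rule int, assumption, rule set_integrable_subset[where A = "{0..T}"])
      (use that t in \<open>auto simp: L1_space_def\<close>)
  have "(LINT s:{0..t}|lebesgue. S (t - s) (F1 s)) - (LINT s:{0..t}|lebesgue. S (t - s) (F2 s))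
      = (LINT s:{0..t}|lebesgue. S (t - s) (F1 s - F2 s))"
    by (simp only: set_integral_diff(2)[OF intF[OF F(1)] intF[OF F(2)], symmetric] blinfun.diff_right)
  moreover have "(LINT s:{0..t}|lebesgue. S (t - s) (kernel_conv K1 z1 s))
      - (LINT s:{0..t}|lebesgue. S (t - s) (kernel_conv K2 z2 s))
      = (LINT s:{0..t}|lebesgue. S (t - s) (kernel_conv K1 z1 s) - S (t - s) (kernel_conv K2 z2 s))"
    by (rule set_integral_diff(2)[symmetric]) (rule intK K z)+
  moreover have "\<dots> = (LINT s:{0..t}|lebesgue. S (t - s) (kernel_conv K1 (\<lambda>r. z1 r - z2 r) s)
      + S (t - s) (kernel_conv (\<lambda>r. K1 r - K2 r) z2 s))"
    using t kernel_conv_diff[OF K _ z]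
    by (intro set_lebesgue_integral_cong) (auto simp flip: blinfun.diff_right blinfun.add_right)
  moreover have "\<dots> = (LINT s:{0..t}|lebesgue. S (t - s) (kernel_conv K1 (\<lambda>r. z1 r - z2 r) s))
      + (LINT s:{0..t}|lebesgue. S (t - s) (kernel_conv (\<lambda>r. K1 r - K2 r) z2 s))"
    by (rule set_integral_add(2); rule intK) (intro K z kernel_space_diff continuous_intros)+
  moreover have "z1 t = S t z01 + (LINT s:{0..t}|lebesgue. S (t - s) (F1 s))
      + (LINT s:{0..t}|lebesgue. S (t - s) (kernel_conv K1 z1 s))"
    "z2 t = S t z02 + (LINT s:{0..t}|lebesgue. S (t - s) (F2 s))
      + (LINT s:{0..t}|lebesgue. S (t - s) (kernel_conv K2 z2 s))"
    using sol t by (auto simp: mild_solution_def)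
  ultimately show ?thesis
    by (simp add: blinfun.diff_right algebra_simps)
qed

text \<open>Only \<open>K1\<close> enters the exponent, because after the splitting of the
  difference it is the kernel that acts on the unknown. The symmetric maximum follows from this by
  monotonicity.\<close>

lemma mild_solution_stability:
  fixes S :: "real \<Rightarrow> 'h::{real_inner, banach, second_countable_topology} \<Rightarrow>\<^sub>L 'h"
  assumes T: "0 \<le> T" and S: "\<And>x. continuous_on {0..} (\<lambda>t. S t x)"
    and \<sigma>: "\<And>s. s \<in> {0..T} \<Longrightarrow> norm (S s) \<le> \<sigma>"
    and K: "K1 \<in> kernel_space T" "K2 \<in> kernel_space T"
    and F: "F1 \<in> L1_space T" "F2 \<in> L1_space T"
    and sol: "mild_solution T S K1 F1 z01 z1" "mild_solution T S K2 F2 z02 z2"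
  shows "sup_norm T (\<lambda>t. z1 t - z2 t) \<le> \<sigma> * exp (\<sigma> * kernel_norm T K1 * T) *
    (norm (z01 - z02) + L1_norm T (\<lambda>t. F1 t - F2 t)
      + T * kernel_norm T (\<lambda>t. K1 t - K2 t) * sup_norm T z2)"
proof -
  define w where "w t = z1 t - z2 t" for t
  \<comment> \<open>This rate makes \<open>c\<close> times the integral of
    \<open>exp (c * s)\<close> over \<open>{0..t}\<close> equal to \<open>exp (c * t) - 1\<close>,
    which is the form that \<open>exp_weighted_gronwall\<close> requires.\<close>
  define c where "c = \<sigma> * kernel_norm T K1"
  define dK where "dK t = K1 t - K2 t" for t
  define a where "a = norm (z01 - z02) + L1_norm T (\<lambda>t. F1 t - F2 t)
    + T * kernel_norm T dK * sup_norm T z2"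
  have z: "continuous_on {0..T} z1" "continuous_on {0..T} z2"
    using sol by (auto simp: mild_solution_def)
  have w: "continuous_on {0..T} w"
    unfolding w_def by (intro continuous_intros z)
  have dK: "dK \<in> kernel_space T"
    unfolding dK_def by (rule kernel_space_diff[OF K])
  have \<sigma>0: "0 \<le> \<sigma>"
    using order_trans[OF norm_ge_zero \<sigma>[of 0]] T by simp
  have c: "0 \<le> c"
    using \<sigma>0 by (simp add: c_def kernel_norm_nonneg)
  have dF: "set_integrable lebesgue {0..T} (\<lambda>t. F1 t - F2 t)"
    using F by (auto simp: L1_space_def)
  \<comment> \<open>The three data terms contribute \<open>\<sigma> * a\<close>; the convolution of
    \<open>K1\<close> with \<open>w\<close> is the only term that depends on
    \<open>q\<close>.\<close>
  have step: "norm (w t) \<le> \<sigma> * a + q * (exp (c * t) - 1)"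
    if t: "t \<in> {0..T}" and q: "\<And>r. r \<in> {0..t} \<Longrightarrow> norm (w r) \<le> q * exp (c * r)" for q t
  proof -
    have \<sigma>t: "norm (S s) \<le> \<sigma>" if "s \<in> {0..t}" for s
      using \<sigma> that t by simp
    have q0: "0 \<le> q"
      using order_trans[OF norm_ge_zero q[of 0]] t by simp
    have sub: "continuous_on {0..s} f" if "continuous_on {0..T} f" "s \<in> {0..t}" for s and f :: "real \<Rightarrow> 'h"
      using that(2) t by (intro continuous_on_subset[OF that(1)]) auto
    have cont: "continuous_on {0..t} (kernel_conv K1 w)" "continuous_on {0..t} (kernel_conv dK z2)"
      using t by (auto intro!: sub[where s = t] continuous_on_kernel_conv[OF K(1) w]
          continuous_on_kernel_conv[OF dK z(2)])
    have "norm (S t (z01 - z02)) \<le> \<sigma> * norm (z01 - z02)"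
      by (intro order_trans[OF norm_blinfun] mult_right_mono \<sigma> t norm_ge_zero)
    moreover have "norm (LINT s:{0..t}|lebesgue. S (t - s) (F1 s - F2 s))
        \<le> \<sigma> * L1_norm T (\<lambda>t. F1 t - F2 t)"
    proof -
      have "norm (LINT s:{0..t}|lebesgue. S (t - s) (F1 s - F2 s)) \<le> \<sigma> * L1_norm t (\<lambda>t. F1 t - F2 t)"
        using t by (intro norm_semigroup_integral_le S \<sigma>t set_integrable_subset[OF dF]) auto
      also have "\<dots> \<le> \<sigma> * L1_norm T (\<lambda>t. F1 t - F2 t)"
        using t by (intro mult_left_mono L1_norm_mono_interval dF \<sigma>0) auto
      finally show ?thesis .
    qed
    moreover have "norm (LINT s:{0..t}|lebesgue. S (t - s) (kernel_conv dK z2 s))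
        \<le> \<sigma> * (T * kernel_norm T dK * sup_norm T z2)"
    proof -
      \<comment> \<open>The convolution is bounded by a constant at each time, and integrating that
        constant produces the factor \<open>T\<close> in the claim.\<close>
      have "L1_norm t (kernel_conv dK z2) \<le> (LINT s:{0..t}|lebesgue. kernel_norm T dK * sup_norm T z2)"
        using t by (intro L1_norm_le cont continuous_intros norm_kernel_conv_le dK sub[OF z(2)]
            sup_norm_upper z) auto
      also have "\<dots> = t * (kernel_norm T dK * sup_norm T z2)"
        using t by (subst set_integral_const) auto
      also have "\<dots> \<le> T * (kernel_norm T dK * sup_norm T z2)"
        using t by (intro mult_right_mono mult_nonneg_nonneg kernel_norm_nonneg sup_norm_nonneg z T) auto
      finally have "\<sigma> * L1_norm t (kernel_conv dK z2) \<le> \<sigma> * (T * kernel_norm T dK * sup_norm T z2)"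
        using \<sigma>0 by (simp add: mult_left_mono mult.assoc)
      moreover have "norm (LINT s:{0..t}|lebesgue. S (t - s) (kernel_conv dK z2 s))
          \<le> \<sigma> * L1_norm t (kernel_conv dK z2)"
        by (intro norm_semigroup_integral_le S \<sigma>t set_integrable_lebesgue_continuous cont)
      ultimately show ?thesis by simp
    qed
    moreover have "norm (LINT s:{0..t}|lebesgue. S (t - s) (kernel_conv K1 w s))
        \<le> q * (exp (c * t) - 1)"
    proof -
      have "norm (kernel_conv K1 w s) \<le> kernel_norm T K1 * (q * exp (c * s))" if s: "s \<in> {0..t}" for s
      proof (rule norm_kernel_conv_le[OF K(1) _ sub[OF w s]])
        fix r assume r: "r \<in> {0..s}"
        then have "norm (w r) \<le> q * exp (c * r)"
          using s by (intro q) auto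
        \<comment> \<open>As \<open>c\<close> and \<open>q\<close> are nonnegative, the value at the
          right end \<open>s\<close> is a constant bound on \<open>{0..s}\<close>, as
          \<open>norm_kernel_conv_le\<close> demands.\<close>
        also have "\<dots> \<le> q * exp (c * s)"
          using r c q0 by (auto intro!: mult_left_mono)
        finally show "norm (w r) \<le> q * exp (c * s)" .
      qed (use s t in auto)
      then have "L1_norm t (kernel_conv K1 w)
          \<le> (LINT s:{0..t}|lebesgue. kernel_norm T K1 * (q * exp (c * s)))"
        by (intro L1_norm_le cont continuous_intros)
      also have "\<dots> = kernel_norm T K1 * q * L1_norm t (\<lambda>s. exp (c * s))"
        by (simp add: L1_norm_def mult.assoc)
      finally have "\<sigma> * L1_norm t (kernel_conv K1 w)
          \<le> \<sigma> * (kernel_norm T K1 * q * L1_norm t (\<lambda>s. exp (c * s)))"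
        using \<sigma>0 by (rule mult_left_mono)
      also have "\<dots> = q * (c * L1_norm t (\<lambda>s. exp (c * s)))"
        by (simp add: c_def)
      also have "\<dots> = q * (exp (c * t) - 1)"
        using t by (simp add: L1_norm_exp)
      finally show ?thesis
        using norm_semigroup_integral_le[OF S \<sigma>t set_integrable_lebesgue_continuous[OF cont(1)]]
        by simp
    qed
    moreover have "w t = S t (z01 - z02) + (LINT s:{0..t}|lebesgue. S (t - s) (F1 s - F2 s))
        + (LINT s:{0..t}|lebesgue. S (t - s) (kernel_conv K1 w s))
        + (LINT s:{0..t}|lebesgue. S (t - s) (kernel_conv dK z2 s))"
      using mild_solution_diff[OF S \<sigma> K F sol t] unfolding w_def dK_def .
    moreover have "norm (x1 + x2 + x3 + x4) \<le> norm x1 + norm x2 + norm x3 + norm x4"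
      for x1 x2 x3 x4 :: 'h
      by (intro norm_triangle_le add_mono order_refl)
    ultimately show ?thesis
      by (smt (verit) a_def distrib_left)
  qed
  have "norm (w t) \<le> \<sigma> * a * exp (c * T)" if "t \<in> {0..T}" for t
    by (rule exp_weighted_gronwall[OF w c that step])
  then have "sup_norm T w \<le> \<sigma> * a * exp (c * T)"
    unfolding sup_norm_def using T by (intro cSUP_least) auto
  then show ?thesis
    unfolding w_def dK_def a_def c_def by (simp add: mult_ac)
qed

section \<open>Continuous dependence on the data\<close>

text \<open>Along a convergent sequence of kernels this controls the exponent by a convergent
  quantity.\<close>

lemma kernel_norm_le_add_diff:
  assumes "K1 \<in> kernel_space T" "K2 \<in> kernel_space T"
  shows "kernel_norm T K1 \<le> kernel_norm T K2 + kernel_norm T (\<lambda>t. K1 t - K2 t)"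
proof -
  note int = kernel_space_integrable_norm[OF assms(1)] kernel_space_integrable_norm[OF assms(2)]
    kernel_space_integrable_norm[OF kernel_space_diff[OF assms]]
  have "kernel_norm T K1 \<le> (LINT t:{0..T}|lebesgue. norm (K2 t) + norm (K1 t - K2 t))"
    unfolding kernel_norm_def
    by (intro set_integral_mono set_integral_add int norm_triangle_sub)
  then show ?thesis
    by (simp add: kernel_norm_def int)
qed

theorem theorem4p6:
  fixes D :: "'h::{real_inner, banach, second_countable_topology} set"
    and A :: "'h \<Rightarrow> 'h"
    and S :: "real \<Rightarrow> 'h \<Rightarrow>\<^sub>L 'h"
    and T M \<omega> \<sigma> :: real
  assumes "T > 0"
    and "generates_semigroup D A S"
    and "M \<ge> 1"
    and "\<And>t. t \<ge> 0 \<Longrightarrow> norm (S t) \<le> M * exp (\<omega> * t)"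
    and "\<sigma> = M * exp (max \<omega> 0 * T)"
  shows
    "(\<forall>K1 K2 F1 F2 z01 z02 z1 z2.
        K1 \<in> kernel_space T \<and> K2 \<in> kernel_space T \<and>
        F1 \<in> L1_space T \<and> F2 \<in> L1_space T \<and>
        mild_solution T S K1 F1 z01 z1 \<and> mild_solution T S K2 F2 z02 z2 \<longrightarrow>
        sup_norm T (\<lambda>t. z1 t - z2 t)
          \<le> \<sigma> * exp (\<sigma> * max (kernel_norm T K1) (kernel_norm T K2) * T) *
            (norm (z01 - z02) + L1_norm T (\<lambda>t. F1 t - F2 t)
              + T * kernel_norm T (\<lambda>t. K1 t - K2 t) * sup_norm T z2))
     \<and>
     (\<forall>Kn K Fn F z0n z0 zn z.
        (\<forall>n::nat. Kn n \<in> kernel_space T) \<and> K \<in> kernel_space T \<and>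
        (\<forall>n. Fn n \<in> L1_space T) \<and> F \<in> L1_space T \<and>
        (\<forall>n. mild_solution T S (Kn n) (Fn n) (z0n n) (zn n)) \<and> mild_solution T S K F z0 z \<and>
        z0n \<longlonglongrightarrow> z0 \<and>
        (\<lambda>n. L1_norm T (\<lambda>t. Fn n t - F t)) \<longlonglongrightarrow> 0 \<and>
        (\<lambda>n. kernel_norm T (\<lambda>t. Kn n t - K t)) \<longlonglongrightarrow> 0 \<longrightarrow>
        (\<lambda>n. sup_norm T (\<lambda>t. zn n t - z t)) \<longlonglongrightarrow> 0)"

proof -
  have T: "0 \<le> T" and S: "\<And>x. continuous_on {0..} (\<lambda>t. S t x)"
    using assms(1,2) by (auto simp: generates_semigroup_def C0_semigroup_def)
  have \<sigma>0: "0 \<le> \<sigma>"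
    using assms(3,5) by simp
  have \<sigma>: "norm (S s) \<le> \<sigma>" if "s \<in> {0..T}" for s
  proof -
    \<comment> \<open>Passing to \<open>max \<omega> 0\<close> makes the exponent nondecreasing in
      time, so its value at \<open>T\<close> covers negative \<open>\<omega>\<close> as
      well.\<close>
    have "\<omega> * s \<le> max \<omega> 0 * T"
      using that by (intro mult_mono) auto
    then show ?thesis
      using assms(3-5) that by (smt (verit) atLeastAtMost_iff exp_le_cancel_iff mult_left_mono)
  qed
  note stab = mild_solution_stability[OF T S \<sigma>]
  show ?thesis
  proof (intro conjI allI impI; elim conjE)
    fix K1 K2 F1 F2 z01 z02 z1 z2
    assume K: "K1 \<in> kernel_space T" "K2 \<in> kernel_space T"
      and F: "F1 \<in> L1_space T" "F2 \<in> L1_space T"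
      and sol: "mild_solution T S K1 F1 z01 z1" "mild_solution T S K2 F2 z02 z2"
    define a where "a = norm (z01 - z02) + L1_norm T (\<lambda>t. F1 t - F2 t)
      + T * kernel_norm T (\<lambda>t. K1 t - K2 t) * sup_norm T z2"
    have "0 \<le> sup_norm T z2"
      using sol T by (intro sup_norm_nonneg) (auto simp: mild_solution_def)
    then have "0 \<le> a"
      using T by (simp add: a_def L1_norm_nonneg kernel_norm_nonneg)
    have "sup_norm T (\<lambda>t. z1 t - z2 t) \<le> \<sigma> * exp (\<sigma> * kernel_norm T K1 * T) * a"
      unfolding a_def by (rule stab[OF _ K F sol])
    \<comment> \<open>Only the exponential grows here; \<open>\<sigma>\<close> and \<open>a\<close>
      are nonnegative, so the product grows with it.\<close>
    also have "\<dots> \<le> \<sigma> * exp (\<sigma> * max (kernel_norm T K1) (kernel_norm T K2) * T) * a"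
      using T \<sigma>0 \<open>0 \<le> a\<close> by (intro mult_right_mono mult_left_mono) (auto intro!: mult_right_mono mult_left_mono)
    finally show "sup_norm T (\<lambda>t. z1 t - z2 t)
        \<le> \<sigma> * exp (\<sigma> * max (kernel_norm T K1) (kernel_norm T K2) * T) *
          (norm (z01 - z02) + L1_norm T (\<lambda>t. F1 t - F2 t)
            + T * kernel_norm T (\<lambda>t. K1 t - K2 t) * sup_norm T z2)"
      by (simp add: a_def)
  next
    fix Kn K Fn F z0n z0 zn z
    assume K: "\<forall>n::nat. Kn n \<in> kernel_space T" "K \<in> kernel_space T"
      and F: "\<forall>n. Fn n \<in> L1_space T" "F \<in> L1_space T"
      and sol: "\<forall>n. mild_solution T S (Kn n) (Fn n) (z0n n) (zn n)" "mild_solution T S K F z0 z"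
      and lim: "z0n \<longlonglongrightarrow> z0" "(\<lambda>n. L1_norm T (\<lambda>t. Fn n t - F t)) \<longlonglongrightarrow> 0"
        "(\<lambda>n. kernel_norm T (\<lambda>t. Kn n t - K t)) \<longlonglongrightarrow> 0"
    define d where "d n = kernel_norm T (\<lambda>t. Kn n t - K t)" for n
    define a where "a n = norm (z0n n - z0) + L1_norm T (\<lambda>t. Fn n t - F t)
      + T * d n * sup_norm T z" for n
    have d: "d \<longlonglongrightarrow> 0"
      using lim(3) by (simp add: d_def[abs_def])
    have nonneg: "0 \<le> sup_norm T (\<lambda>t. zn n t - z t)" for n
      using sol T by (intro sup_norm_nonneg continuous_intros) (auto simp: mild_solution_def)
    have "0 \<le> sup_norm T z"
      using sol T by (intro sup_norm_nonneg) (auto simp: mild_solution_def)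
    then have a0: "0 \<le> a n" for n
      using T by (simp add: a_def d_def L1_norm_nonneg kernel_norm_nonneg)
    have bound: "sup_norm T (\<lambda>t. zn n t - z t) \<le> \<sigma> * exp (\<sigma> * (kernel_norm T K + d n) * T) * a n" for n
    proof -
      \<comment> \<open>The limit takes the second place in the stability estimate, so the bracket
        \<open>a n\<close> contains the fixed \<open>sup_norm T z\<close> instead of the norms of
        the varying \<open>zn n\<close>.\<close>
      have "sup_norm T (\<lambda>t. zn n t - z t) \<le> \<sigma> * exp (\<sigma> * kernel_norm T (Kn n) * T) * a n"
        unfolding a_def d_def using K F sol by (intro stab) auto
      also have "kernel_norm T (Kn n) \<le> kernel_norm T K + d n"
        unfolding d_def using K by (intro kernel_norm_le_add_diff) auto
      finally show ?thesis
        using T \<sigma>0 a0 by (simp add: mult_right_mono mult_left_mono)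
    qed
    have "(\<lambda>n. \<sigma> * exp (\<sigma> * (kernel_norm T K + d n) * T) * a n) \<longlonglongrightarrow>
        \<sigma> * exp (\<sigma> * (kernel_norm T K + 0) * T) * (norm (z0 - z0) + 0 + T * 0 * sup_norm T z)"
      unfolding a_def by (intro tendsto_intros lim d)
    then have "(\<lambda>n. \<sigma> * exp (\<sigma> * (kernel_norm T K + d n) * T) * a n) \<longlonglongrightarrow> 0"
      by simp
    then show "(\<lambda>n. sup_norm T (\<lambda>t. zn n t - z t)) \<longlonglongrightarrow> 0"
      by (rule real_tendsto_sandwich[OF always_eventually always_eventually tendsto_const, rotated 2])
        (intro allI nonneg bound)+
  qed
qed

end
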